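(* Let $\mathbb{F}=\mathbb{R}$ or $\mathbb{C}$, let $v_1,\ldots,v_p\in\mathbb{F}^n$, and let $B=v_1\wedge\cdots\wedge v_p\in\bigwedge^p\mathbb{F}^n$. (i) If $\mathbb{F}=\mathbb{R}$, then $\|B\|=\mathcal{V}_p(v_1,\ldots,v_p)$. (ii) If $\mathbb{F}=\mathbb{C}$, then $\|B\|=\sqrt{\mathcal{V}_{2p}(v_1,\mathrm{i}v_1,\ldots,v_p,\mathrm{i}v_p)}$.
   Context: $\langle\cdot,\cdot\rangle$ is the canonical inner product on $\mathbb{R}^n$ or the canonical Hermitian product on $\mathbb{C}^n$ (conjugate-linear in the first entry). $\bigwedge\mathbb{F}^n$ is the Grassmann (exterior) algebra of $\mathbb{F}^n$ over $\mathbb{F}$, with the inner (Hermitian, if $\mathbb{F}=\mathbb{C}$) product determined by $\langle u_1\wedge\cdots\wedge u_k,v_1\wedge\cdots\wedge v_k\rangle=\det\big(\langle u_i,v_j\rangle\big)$ (different grades being orthogonal), and $\|B\|=\sqrt{\langle B,B\rangle}$. $\langle\cdot,\cdot\rangle_{\mathbb{R}}=\langle\cdot,\cdot\rangle$ if $\mathbb{F}=\mathbb{R}$, and $\langle\cdot,\cdot\rangle_{\mathbb{R}}=\operatorname{Re}\langle\cdot,\cdot\rangle$ if $\mathbb{F}=\mathbb{C}$ (the Euclidean inner product of the underlying real space $(\mathbb{C}^n)_{\mathbb{R}}=\mathbb{R}^{2n}$). For vectors $v_1,\ldots,v_p\in\mathbb{F}^n$, $\mathcal{V}_p(v_1,\ldots,v_p)$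 (also written $\mathcal{V}(v_1,\ldots,v_p)$) is the real $p$-dimensional volume of the parallelotope $\{\sum_{j=1}^p t_jv_j:0\le t_j\le1\}$, defined recursively by $\mathcal{V}(v_1)=\|v_1\|$ and $\mathcal{V}(v_1,\ldots,v_k)=\mathcal{V}(v_1,\ldots,v_{k-1})\cdot\|u_k\|$ for $2\le k\le p$, where $u_k=v_k-\sum_{j=1}^{k-1}c_jv_j$ with $c_j\in\mathbb{R}$ such that $\langle v_j,u_k\rangle_{\mathbb{R}}=0$ for all $j<k$. *)

theory Defs
  imports "HOL-Analysis.Analysis" "Jordan_Normal_Form.Determinant" "Jordan_Normal_Form.Conjugate"
begin

no_notation Matrix.vec_index (infixl "$" 100)
no_notation Matrix.scalar_prod (infix "\<bullet>" 70)
hide_type (open) Matrix.vec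

text \<open>
  The Grassmann algebra of \<open>F\<^sup>n\<close> is modelled by \<open>'f ^ 'n set\<close>: the coordinate at
  \<open>K = {k1 < ... < kr}\<close> is the coefficient of \<open>e_k1 \<and> ... \<and> e_kr\<close>. An index type of class
  \<open>finite\<close> carries no order, so the order transported from \<open>nat\<close> by \<open>to_nat\<close> is used.
\<close>

text \<open>For disjoint \<open>I\<close>, \<open>J\<close>: the sign in \<open>e_I \<and> e_J = \<plusminus> e_(I \<union> J)\<close>.\<close>

definition shuffle_sign :: "'n::finite set \<Rightarrow> 'n set \<Rightarrow> 'f::field" where
  "shuffle_sign I J = (- 1) ^ card {(i, j). i \<in> I \<and> j \<in> J \<and> to_nat j < to_nat i}"

definition wedge :: "'f::field ^ ('n::finite set) \<Rightarrow> 'f ^ ('n set) \<Rightarrow> 'f ^ ('n set)"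
    (infixr "\<and>\<^sub>G" 72) where
  "A \<and>\<^sub>G B = (\<chi> K. \<Sum>I\<in>Pow K. shuffle_sign I (K - I) * A $ I * B $ (K - I))"

definition mv_one :: "'f::field ^ ('n::finite set)" where
  "mv_one = axis {} 1"

definition mv_vector :: "'f::field ^ 'n::finite \<Rightarrow> 'f ^ ('n set)" where
  "mv_vector u = (\<Sum>i\<in>UNIV. u $ i *s axis {i} 1)"

definition wedge_list :: "('f::field ^ 'n::finite) list \<Rightarrow> 'f ^ ('n set)" where
  "wedge_list us = foldr (\<lambda>u A. mv_vector u \<and>\<^sub>G A) us mv_one"

definition herm :: "'f::conjugatable_field ^ 'm::finite \<Rightarrow> 'f ^ 'm \<Rightarrow> 'f" where
  "herm u v = (\<Sum>i\<in>UNIV. conjugate (u $ i) * v $ i)"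

definition gram_det :: "('f::conjugatable_field ^ 'n::finite) list \<Rightarrow> ('f ^ 'n) list \<Rightarrow> 'f" where
  "gram_det us vs =
     Determinant.det (Matrix.mat (length us) (length vs) (\<lambda>(i, j). herm (us ! i) (vs ! j)))"

text \<open>Hermitian symmetry makes the form conjugate-linear in its first argument.\<close>

definition is_grassmann_inner ::
    "('f::conjugatable_field ^ ('n::finite set) \<Rightarrow> 'f ^ ('n set) \<Rightarrow> 'f) \<Rightarrow> bool" where
  "is_grassmann_inner ip \<longleftrightarrow>
     (\<forall>A B C. ip A (B + C) = ip A B + ip A C) \<and>
     (\<forall>A B c. ip A (c *s B) = c * ip A B) \<and>
     (\<forall>A B. ip B A = conjugate (ip A B)) \<and>
     (\<forall>us vs. length us = length vs \<longrightarrow> ip (wedge_list us) (wedge_list vs) = gram_det us vs) \<and>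
     (\<forall>us vs. length us \<noteq> length vs \<longrightarrow> ip (wedge_list us) (wedge_list vs) = 0)"

text \<open>Existence and uniqueness are shown in \<open>ex1_grassmann_inner\<close> below.\<close>

definition grassmann_inner ::
    "'f::conjugatable_field ^ ('n::finite set) \<Rightarrow> 'f ^ ('n set) \<Rightarrow> 'f" where
  "grassmann_inner = (THE ip. is_grassmann_inner ip)"

text \<open>\<open>grassmann_inner B B\<close> is a nonnegative real also for complex scalars
  (\<open>grassmann_inner_self_complex\<close>), so taking the real part loses nothing.\<close>

definition mv_norm_real :: "real ^ ('n::finite set) \<Rightarrow> real" where
  "mv_norm_real B = sqrt (grassmann_inner B B)"

definition mv_norm_complex :: "complex ^ ('n::finite set) \<Rightarrow> real" where
  "mv_norm_complex B = sqrt (Re (grassmann_inner B B))"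

text \<open>
  The library's \<open>\<bullet>\<close> is the canonical inner product on \<open>real ^ 'n\<close> and the real part of the canonical
  Hermitian product on \<open>complex ^ 'n\<close> (\<open>inner_eq_Re_herm\<close>), and \<open>*\<^sub>R\<close> only uses real coefficients.
\<close>

definition perp_part :: "'a::real_inner list \<Rightarrow> 'a \<Rightarrow> 'a" where
  "perp_part vs v = (THE u. \<exists>c. u = v - (\<Sum>j<length vs. c j *\<^sub>R vs ! j) \<and>
                            (\<forall>j<length vs. vs ! j \<bullet> u = 0))"

text \<open>The value on the empty list is the usual convention for a 0-dimensional volume.\<close>

fun parallelotope_vol :: "'a::real_inner list \<Rightarrow> real" where
  "parallelotope_vol [] = 1"
| "parallelotope_vol [v] = norm v"
| "parallelotope_vol (v # w # vs) =
     parallelotope_vol (butlast (v # w # vs)) *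
     norm (perp_part (butlast (v # w # vs)) (last (v # w # vs)))"


section \<open>The definite descriptions are well defined\<close>

lemma ex1_perp_part:
  fixes v :: "'a::euclidean_space"
  shows "\<exists>!u. \<exists>c. u = v - (\<Sum>j<length vs. c j *\<^sub>R vs ! j) \<and> (\<forall>j<length vs. vs ! j \<bullet> u = 0)"
proof (rule ex_ex1I)
  let ?S = "range (\<lambda>c. \<Sum>j<length vs. c j *\<^sub>R vs ! j)"
  have sub: "span (set vs) \<subseteq> ?S"
  proof (rule span_minimal)
    show "set vs \<subseteq> ?S"
    proof
      fix x assume "x \<in> set vs"
      then obtain k where k: "k < length vs" "x = vs ! k" by (auto simp: in_set_conv_nth)
      have "x = (\<Sum>j<length vs. (if j = k then 1 else 0) *\<^sub>R vs ! j)"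
        using k by (simp add: if_distrib[of "\<lambda>a. a *\<^sub>R _"] cong: if_cong)
      then show "x \<in> ?S" by (rule range_eqI[where x = "\<lambda>j. if j = k then 1 else 0"])
    qed
    show "subspace ?S"
    proof (rule subspaceI)
      show "0 \<in> ?S" by (rule range_eqI[where x = "\<lambda>_. 0"]) simp
      show "x + y \<in> ?S" if "x \<in> ?S" "y \<in> ?S" for x y
      proof -
        from that obtain c d where "x = (\<Sum>j<length vs. c j *\<^sub>R vs ! j)"
          "y = (\<Sum>j<length vs. d j *\<^sub>R vs ! j)" by blast
        then have "x + y = (\<Sum>j<length vs. (c j + d j) *\<^sub>R vs ! j)"
          by (simp add: scaleR_add_left sum.distrib)
        then show ?thesis by (rule range_eqI[where x = "\<lambda>j. c j + d j"])
      qed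
      show "a *\<^sub>R x \<in> ?S" if "x \<in> ?S" for a x
      proof -
        from that obtain c where "x = (\<Sum>j<length vs. c j *\<^sub>R vs ! j)" by blast
        then have "a *\<^sub>R x = (\<Sum>j<length vs. (a * c j) *\<^sub>R vs ! j)"
          by (simp add: scaleR_sum_right)
        then show ?thesis by (rule range_eqI[where x = "\<lambda>j. a * c j"])
      qed
    qed
  qed
  obtain y z where yz: "y \<in> span (set vs)" "\<And>w. w \<in> span (set vs) \<Longrightarrow> Linear_Algebra.orthogonal z w" "v = y + z"
    using orthogonal_subspace_decomp_exists[of "set vs" v] by metis
  from yz(1) sub obtain c where c: "y = (\<Sum>j<length vs. c j *\<^sub>R vs ! j)" by blast
  have "z = v - (\<Sum>j<length vs. c j *\<^sub>R vs ! j)" using yz(3) c by simp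
  moreover have "\<forall>j<length vs. vs ! j \<bullet> z = 0"
    using yz(2)[unfolded Linear_Algebra.orthogonal_def]
    by (metis inner_commute nth_mem span_base)
  ultimately show "\<exists>u c. u = v - (\<Sum>j<length vs. c j *\<^sub>R vs ! j) \<and> (\<forall>j<length vs. vs ! j \<bullet> u = 0)"
    by blast
next
  fix u u'
  assume "\<exists>c. u = v - (\<Sum>j<length vs. c j *\<^sub>R vs ! j) \<and> (\<forall>j<length vs. vs ! j \<bullet> u = 0)"
    and "\<exists>c. u' = v - (\<Sum>j<length vs. c j *\<^sub>R vs ! j) \<and> (\<forall>j<length vs. vs ! j \<bullet> u' = 0)"
  then obtain c d where
    u: "u = v - (\<Sum>j<length vs. c j *\<^sub>R vs ! j)" "\<forall>j<length vs. vs ! j \<bullet> u = 0" and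
    u': "u' = v - (\<Sum>j<length vs. d j *\<^sub>R vs ! j)" "\<forall>j<length vs. vs ! j \<bullet> u' = 0" by blast
  have "u - u' = (\<Sum>j<length vs. (d j - c j) *\<^sub>R vs ! j)"
    unfolding u(1) u'(1) by (simp add: scaleR_diff_left sum_subtractf)
  then have "(u - u') \<bullet> (u - u') = (\<Sum>j<length vs. (d j - c j) *\<^sub>R vs ! j) \<bullet> (u - u')" by simp
  also have "\<dots> = 0"
    unfolding inner_sum_left
    by (rule sum.neutral) (use u(2) u'(2) in \<open>simp add: inner_diff_right\<close>)
  finally show "u = u'" by simp
qed

lemma inner_eq_herm: "u \<bullet> v = herm u v" for u v :: "real ^ 'n::finite"
  by (simp add: inner_vec_def herm_def)

lemma inner_eq_Re_herm: "u \<bullet> v = Re (herm u v)" for u v :: "complex ^ 'n::finite"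
  by (simp add: inner_vec_def herm_def inner_complex_def)

lemma shuffle_sign_sq: "shuffle_sign I J * shuffle_sign I J = (1 :: 'f::field)"
  by (simp add: shuffle_sign_def flip: power_mult_distrib)

lemma shuffle_sign_empty [simp]: "shuffle_sign {} J = (1 :: 'f::field)" "shuffle_sign I {} = (1 :: 'f)"
  by (simp_all add: shuffle_sign_def)

lemma shuffle_sign_Un_left:
  assumes "I \<inter> J = {}"
  shows "shuffle_sign (I \<union> J) K = shuffle_sign I K * (shuffle_sign J K :: 'f::field)"
proof -
  have "{(i, j). i \<in> I \<union> J \<and> j \<in> K \<and> to_nat j < to_nat i} =
        {(i, j). i \<in> I \<and> j \<in> K \<and> to_nat j < to_nat i} \<union>
        {(i, j). i \<in> J \<and> j \<in> K \<and> to_nat j < to_nat i}" by auto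
  moreover have "{(i, j). i \<in> I \<and> j \<in> K \<and> to_nat j < to_nat i} \<inter>
        {(i, j). i \<in> J \<and> j \<in> K \<and> to_nat j < to_nat i} = {}" using assms by auto
  ultimately show ?thesis
    by (simp add: shuffle_sign_def card_Un_disjoint power_add)
qed

lemma shuffle_sign_Un_right:
  assumes "J \<inter> K = {}"
  shows "shuffle_sign I (J \<union> K) = shuffle_sign I J * (shuffle_sign I K :: 'f::field)"
proof -
  have "{(i, j). i \<in> I \<and> j \<in> J \<union> K \<and> to_nat j < to_nat i} =
        {(i, j). i \<in> I \<and> j \<in> J \<and> to_nat j < to_nat i} \<union>
        {(i, j). i \<in> I \<and> j \<in> K \<and> to_nat j < to_nat i}" by auto
  moreover have "{(i, j). i \<in> I \<and> j \<in> J \<and> to_nat j < to_nat i} \<inter>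
        {(i, j). i \<in> I \<and> j \<in> K \<and> to_nat j < to_nat i} = {}" using assms by auto
  ultimately show ?thesis
    by (simp add: shuffle_sign_def card_Un_disjoint power_add)
qed

lemma shuffle_sign_single:
  "shuffle_sign {i} {j} = (if to_nat j < to_nat i then - 1 else 1 :: 'f::field)"
proof -
  have "{(a, b). a \<in> {i} \<and> b \<in> {j} \<and> to_nat b < to_nat a} =
    (if to_nat j < to_nat i then {(i, j)} else {})" by auto
  then show ?thesis by (simp add: shuffle_sign_def)
qed

lemma shuffle_sign_swap:
  assumes "i \<noteq> j"
  shows "shuffle_sign {i} {j} = - (shuffle_sign {j} {i} :: 'f::field)"
proof -
  have "to_nat i \<noteq> to_nat j" using assms by simp
  then show ?thesis by (auto simp: shuffle_sign_single)
qed

lemma mv_vector_nth: "mv_vector u $ I = (\<Sum>i\<in>UNIV. if I = {i} then u $ i else 0)"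
  unfolding mv_vector_def
  by (simp add: axis_def if_distrib[of "\<lambda>a. _ * a"] cong: if_cong)

lemma mv_vector_single [simp]: "mv_vector u $ {i} = u $ i"
  by (simp add: mv_vector_nth)

lemma mv_vector_zero: "(\<And>i. I \<noteq> {i}) \<Longrightarrow> mv_vector u $ I = 0"
  by (simp add: mv_vector_nth)

lemma wedge_vector_nth:
  "(mv_vector u \<and>\<^sub>G A) $ K = (\<Sum>i\<in>K. shuffle_sign {i} (K - {i}) * u $ i * A $ (K - {i}))"
proof -
  have "(mv_vector u \<and>\<^sub>G A) $ K =
    (\<Sum>I\<in>Pow K. shuffle_sign I (K - I) * mv_vector u $ I * A $ (K - I))"
    by (simp add: wedge_def)
  also have "\<dots> = (\<Sum>I\<in>(\<lambda>i. {i}) ` K. shuffle_sign I (K - I) * mv_vector u $ I * A $ (K - I))"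
    by (rule sum.mono_neutral_right) (auto simp: image_iff intro!: mv_vector_zero)
  also have "\<dots> = (\<Sum>i\<in>K. shuffle_sign {i} (K - {i}) * u $ i * A $ (K - {i}))"
    by (subst sum.reindex) (auto simp: inj_on_def)
  finally show ?thesis .
qed


subsection \<open>The exterior algebra relations\<close>

text \<open>The product is associative, unital and bilinear, vectors square to 0, and vectors generate the
  algebra (\<open>ex_wedge_list_axis\<close>). Since the dimension is \<open>2 ^ n\<close>, this determines it as the exterior
  algebra up to unique isomorphism fixing the vectors.\<close>

lemma wedge_assoc: "(A \<and>\<^sub>G B) \<and>\<^sub>G C = A \<and>\<^sub>G (B \<and>\<^sub>G C)"
proof (rule Finite_Cartesian_Product.vec_eq_iff[THEN iffD2], rule allI)
  fix K
  let ?t = "\<lambda>I J L. shuffle_sign I J * shuffle_sign I L * shuffle_sign J L * A $ I * B $ J * C $ L"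
  have "((A \<and>\<^sub>G B) \<and>\<^sub>G C) $ K = (\<Sum>M\<in>Pow K. \<Sum>I\<in>Pow M. ?t I (M - I) (K - M))"
    unfolding wedge_def
  proof (simp add: sum_distrib_left sum_distrib_right, intro sum.cong refl)
    fix M I assume "M \<in> Pow K" "I \<in> Pow M"
    then have "M = I \<union> (M - I)" by auto
    then have "shuffle_sign M (K - M) = shuffle_sign I (K - M) * (shuffle_sign (M - I) (K - M) :: 'a)"
      using shuffle_sign_Un_left[of I "M - I" "K - M"] by auto
    then show "shuffle_sign M (K - M) * (shuffle_sign I (M - I) * A $ I * B $ (M - I)) * C $ (K - M)
      = ?t I (M - I) (K - M)" by simp
  qed
  also have "\<dots> = (\<Sum>(M, I)\<in>Sigma (Pow K) Pow. ?t I (M - I) (K - M))"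
    by (subst sum.Sigma) auto
  also have "\<dots> = (\<Sum>(I, J)\<in>Sigma (Pow K) (\<lambda>I. Pow (K - I)). ?t I J (K - I - J))"
    by (rule sum.reindex_bij_witness[where i = "\<lambda>(I, J). (I \<union> J, I)" and j = "\<lambda>(M, I). (I, M - I)"])
       (auto simp: Diff_eq intro!: arg_cong2[where f = "(*)"] arg_cong[where f = "shuffle_sign _"]
          arg_cong[where f = "vec_nth _"])
  also have "\<dots> = (\<Sum>I\<in>Pow K. \<Sum>J\<in>Pow (K - I). ?t I J (K - I - J))"
    by (subst sum.Sigma) auto
  also have "\<dots> = (A \<and>\<^sub>G (B \<and>\<^sub>G C)) $ K"
    unfolding wedge_def
  proof (simp add: sum_distrib_left sum_distrib_right, intro sum.cong refl)
    fix I J assume "I \<in> Pow K" "J \<in> Pow (K - I)"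
    then have "K - I = J \<union> (K - I - J)" by auto
    then have "shuffle_sign I (K - I) = shuffle_sign I J * (shuffle_sign I (K - I - J) :: 'a)"
      using shuffle_sign_Un_right[of J "K - I - J" I] by auto
    then show "?t I J (K - I - J) =
      shuffle_sign I (K - I) * A $ I * (shuffle_sign J (K - I - J) * B $ J * C $ (K - I - J))" by simp
  qed
  finally show "((A \<and>\<^sub>G B) \<and>\<^sub>G C) $ K = (A \<and>\<^sub>G (B \<and>\<^sub>G C)) $ K" .
qed

lemma wedge_one_left: "mv_one \<and>\<^sub>G A = A"
proof (rule Finite_Cartesian_Product.vec_eq_iff[THEN iffD2], rule allI)
  fix K
  have "(mv_one \<and>\<^sub>G A) $ K =
    (\<Sum>I\<in>Pow K. if I = {} then shuffle_sign I (K - I) * A $ (K - I) else 0)"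
    unfolding wedge_def mv_one_def vec_lambda_beta by (rule sum.cong) (auto simp: axis_def)
  then show "(mv_one \<and>\<^sub>G A) $ K = A $ K" by simp
qed

lemma wedge_one_right: "A \<and>\<^sub>G mv_one = A"
proof (rule Finite_Cartesian_Product.vec_eq_iff[THEN iffD2], rule allI)
  fix K
  have "(A \<and>\<^sub>G mv_one) $ K = (\<Sum>I\<in>Pow K. if I = K then shuffle_sign I (K - I) * A $ I else 0)"
    unfolding wedge_def mv_one_def vec_lambda_beta by (rule sum.cong) (auto simp: axis_def)
  then show "(A \<and>\<^sub>G mv_one) $ K = A $ K" by simp
qed

lemma wedge_add_left: "(A + B) \<and>\<^sub>G C = A \<and>\<^sub>G C + B \<and>\<^sub>G C"
  by (simp add: wedge_def Finite_Cartesian_Product.vec_eq_iff algebra_simps sum.distrib)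

lemma wedge_add_right: "A \<and>\<^sub>G (B + C) = A \<and>\<^sub>G B + A \<and>\<^sub>G C"
  by (simp add: wedge_def Finite_Cartesian_Product.vec_eq_iff algebra_simps sum.distrib)

lemma wedge_scale_left: "(c *s A) \<and>\<^sub>G B = c *s (A \<and>\<^sub>G B)"
  by (simp add: wedge_def Finite_Cartesian_Product.vec_eq_iff algebra_simps sum_distrib_left)

lemma wedge_scale_right: "A \<and>\<^sub>G (c *s B) = c *s (A \<and>\<^sub>G B)"
  by (simp add: wedge_def Finite_Cartesian_Product.vec_eq_iff algebra_simps sum_distrib_left)

lemma wedge_vector_self: "mv_vector u \<and>\<^sub>G mv_vector u = 0"
proof (rule Finite_Cartesian_Product.vec_eq_iff[THEN iffD2], rule allI)
  fix K
  show "(mv_vector u \<and>\<^sub>G mv_vector u) $ K = 0 $ K"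
  proof (cases "\<exists>i j. i \<noteq> j \<and> K = {i, j}")
    case True
    then obtain i j where ij: "i \<noteq> j" "K = {i, j}" by blast
    then have "{i, j} - {i} = {j}" "{i, j} - {j} = {i}" by auto
    then show ?thesis using ij shuffle_sign_swap[OF ij(1), where ?'f = 'a]
      by (simp add: wedge_vector_nth)
  next
    case False
    have "mv_vector u $ (K - {i}) = 0" if "i \<in> K" for i
    proof (rule mv_vector_zero)
      fix j
      show "K - {i} \<noteq> {j}"
      proof
        assume "K - {i} = {j}"
        then have "i \<noteq> j" "K = {i, j}" using that by auto
        then show False using False by blast
      qed
    qed
    then show ?thesis by (simp add: wedge_vector_nth)
  qed
qed

lemma wedge_list_Cons: "wedge_list (u # us) = mv_vector u \<and>\<^sub>G wedge_list us"
  by (simp add: wedge_list_def)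

lemma wedge_list_Nil: "wedge_list [] = mv_one"
  by (simp add: wedge_list_def)

lemma ex_wedge_list_axis:
  fixes K :: "'n::finite set"
  shows "\<exists>us. wedge_list us = (axis K 1 :: 'f::field ^ ('n set))"
proof (induction K rule: finite_induct[OF finite])
  case 1
  show ?case by (metis wedge_list_Nil mv_one_def)
next
  case (2 i K)
  then obtain us where us: "wedge_list us = (axis K 1 :: 'f ^ ('n set))" by blast
  let ?u = "axis i (shuffle_sign {i} K) :: 'f ^ 'n"
  have "wedge_list (?u # us) $ L = (axis (insert i K) 1 :: 'f ^ ('n set)) $ L" for L
  proof -
    have "wedge_list (?u # us) $ L =
      (\<Sum>j\<in>L. if j = i then (if L - {i} = K then 1 else 0) else 0)"
      unfolding wedge_list_Cons wedge_vector_nth us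
      by (rule sum.cong) (auto simp: axis_def shuffle_sign_sq)
    also have "\<dots> = (axis (insert i K) 1 :: 'f ^ ('n set)) $ L"
      using 2 by (auto simp: axis_def)
    finally show ?thesis .
  qed
  then show ?case by (metis Finite_Cartesian_Product.vec_eq_iff)
qed


subsection \<open>The determinant formula\<close>

definition contract :: "'f::conjugatable_field ^ 'n::finite \<Rightarrow> 'f ^ ('n set) \<Rightarrow> 'f ^ ('n set)" where
  "contract u B = (\<chi> K. \<Sum>i\<in>- K. shuffle_sign {i} K * conjugate (u $ i) * B $ (insert i K))"

lemma conjugate_one [simp]: "conjugate (1 :: 'f::conjugatable_field) = 1"
  by (metis conjugate_dist_mul conjugate_id mult.left_neutral mult.right_neutral)

lemma conjugate_shuffle_sign [simp]:
  "conjugate (shuffle_sign I J) = (shuffle_sign I J :: 'f::conjugatable_field)"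
proof -
  have "conjugate ((- 1) ^ n) = ((- 1) ^ n :: 'f)" for n
    by (induction n) (auto simp: conjugate_neg)
  then show ?thesis by (simp add: shuffle_sign_def)
qed

lemma herm_wedge_left: "herm (mv_vector u \<and>\<^sub>G A) B = herm A (contract u B)"
proof -
  have "herm (mv_vector u \<and>\<^sub>G A) B = (\<Sum>K\<in>UNIV. \<Sum>i\<in>K.
      shuffle_sign {i} (K - {i}) * conjugate (u $ i) * conjugate (A $ (K - {i})) * B $ K)"
    by (simp add: herm_def wedge_vector_nth sum_conjugate conjugate_dist_mul sum_distrib_right)
  also have "\<dots> = (\<Sum>(K, i)\<in>Sigma UNIV (\<lambda>K. K).
      shuffle_sign {i} (K - {i}) * conjugate (u $ i) * conjugate (A $ (K - {i})) * B $ K)"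
    by (subst sum.Sigma) auto
  also have "\<dots> = (\<Sum>(K, i)\<in>Sigma UNIV (\<lambda>K. - K).
      shuffle_sign {i} K * conjugate (u $ i) * conjugate (A $ K) * B $ insert i K)"
    by (rule sum.reindex_bij_witness[where i = "\<lambda>(K, i). (insert i K, i)"
          and j = "\<lambda>(K, i). (K - {i}, i)"]) (auto simp: insert_absorb)
  also have "\<dots> = (\<Sum>K\<in>UNIV. \<Sum>i\<in>-K.
      shuffle_sign {i} K * conjugate (u $ i) * conjugate (A $ K) * B $ insert i K)"
    by (subst sum.Sigma) auto
  also have "\<dots> = herm A (contract u B)"
    by (simp add: herm_def contract_def sum_distrib_left mult_ac)
  finally show ?thesis .
qed

lemma contract_wedge:
  "contract u (mv_vector v \<and>\<^sub>G B) = herm u v *s B - mv_vector v \<and>\<^sub>G contract u B"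
proof (rule Finite_Cartesian_Product.vec_eq_iff[THEN iffD2], rule allI)
  fix K
  let ?t = "\<lambda>i j. shuffle_sign {i} K * shuffle_sign {j} (insert i K - {j}) *
               conjugate (u $ i) * v $ j * B $ (insert i K - {j})"
  have "contract u (mv_vector v \<and>\<^sub>G B) $ K = (\<Sum>i\<in>-K. \<Sum>j\<in>insert i K. ?t i j)"
    by (simp add: contract_def wedge_vector_nth sum_distrib_left mult_ac del: sum.insert)
  also have "\<dots> = (\<Sum>i\<in>-K. ?t i i + (\<Sum>j\<in>K. ?t i j))"
    by (intro sum.cong refl sum.insert) auto
  also have "\<dots> = (\<Sum>i\<in>-K. conjugate (u $ i) * v $ i * B $ K) + (\<Sum>i\<in>-K. \<Sum>j\<in>K. ?t i j)"
    by (simp add: sum.distrib shuffle_sign_sq)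
  finally have 1: "contract u (mv_vector v \<and>\<^sub>G B) $ K =
    (\<Sum>i\<in>-K. conjugate (u $ i) * v $ i * B $ K) + (\<Sum>i\<in>-K. \<Sum>j\<in>K. ?t i j)" .
  let ?s = "\<lambda>i j. shuffle_sign {j} (K - {j}) * shuffle_sign {i} (K - {j}) *
               conjugate (u $ i) * v $ j * B $ (insert i (K - {j}))"
  have "(mv_vector v \<and>\<^sub>G contract u B) $ K = (\<Sum>j\<in>K. \<Sum>i\<in>-(K - {j}). ?s i j)"
    by (simp add: contract_def wedge_vector_nth sum_distrib_left mult_ac del: sum.insert)
  also have "\<dots> = (\<Sum>j\<in>K. \<Sum>i\<in>insert j (-K). ?s i j)"
    by (intro sum.cong refl) auto
  also have "\<dots> = (\<Sum>j\<in>K. ?s j j + (\<Sum>i\<in>-K. ?s i j))"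
    by (intro sum.cong refl sum.insert) auto
  also have "\<dots> = (\<Sum>j\<in>K. conjugate (u $ j) * v $ j * B $ K) + (\<Sum>j\<in>K. \<Sum>i\<in>-K. ?s i j)"
    by (simp add: sum.distrib shuffle_sign_sq insert_absorb)
  also have "(\<Sum>j\<in>K. \<Sum>i\<in>-K. ?s i j) = (\<Sum>i\<in>-K. \<Sum>j\<in>K. ?s i j)"
    by (rule sum.swap)
  also have "\<dots> = (\<Sum>i\<in>-K. \<Sum>j\<in>K. - ?t i j)"
  proof (intro sum.cong refl)
    fix i j assume ij: "i \<in> - K" "j \<in> K"
    then have ne: "i \<noteq> j" by auto
    have K: "K = {j} \<union> (K - {j})" and iK: "insert i K - {j} = {i} \<union> (K - {j})"
      and iK': "insert i K - {j} = insert i (K - {j})" using ij ne by auto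
    have a: "shuffle_sign {i} K = shuffle_sign {i} {j} * (shuffle_sign {i} (K - {j}) :: 'a)"
      by (subst K) (rule shuffle_sign_Un_right, auto)
    have b: "shuffle_sign {j} (insert i K - {j}) =
        shuffle_sign {j} {i} * (shuffle_sign {j} (K - {j}) :: 'a)"
      unfolding iK by (rule shuffle_sign_Un_right) (use ij in auto)
    have "shuffle_sign {i} K * shuffle_sign {j} (insert i K - {j}) =
      - (shuffle_sign {j} (K - {j}) * (shuffle_sign {i} (K - {j}) :: 'a))"
      unfolding a b using shuffle_sign_swap[OF ne, where ?'f = 'a] shuffle_sign_sq[of "{j}" "{i}", where ?'f = 'a]
      by (simp add: mult_ac)
    then show "?s i j = - ?t i j" unfolding iK' by simp
  qed
  finally have 2: "(mv_vector v \<and>\<^sub>G contract u B) $ K =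
    (\<Sum>j\<in>K. conjugate (u $ j) * v $ j * B $ K) - (\<Sum>i\<in>-K. \<Sum>j\<in>K. ?t i j)"
    by (simp add: sum_negf)
  have "herm u v * B $ K =
    (\<Sum>i\<in>K. conjugate (u $ i) * v $ i * B $ K) + (\<Sum>i\<in>-K. conjugate (u $ i) * v $ i * B $ K)"
    unfolding herm_def sum_distrib_right
    by (subst sum.union_disjoint[symmetric]) auto
  then show "contract u (mv_vector v \<and>\<^sub>G B) $ K = (herm u v *s B - mv_vector v \<and>\<^sub>G contract u B) $ K"
    using 1 2 by simp
qed

lemma contract_one: "contract u mv_one = 0"
  by (simp add: contract_def mv_one_def axis_def Finite_Cartesian_Product.vec_eq_iff)

abbreviation drop_nth :: "nat \<Rightarrow> 'a list \<Rightarrow> 'a list" where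
  "drop_nth j vs \<equiv> take j vs @ drop (Suc j) vs"

lemma wedge_sum_right: "A \<and>\<^sub>G (\<Sum>j\<in>S. f j) = (\<Sum>j\<in>S. A \<and>\<^sub>G f j)"
proof (induction S rule: infinite_finite_induct)
  case (insert x F)
  then show ?case by (simp add: wedge_add_right)
qed (simp_all add: wedge_def Finite_Cartesian_Product.vec_eq_iff)

lemma contract_wedge_list:
  "contract u (wedge_list vs) =
     (\<Sum>j<length vs. ((- 1) ^ j * herm u (vs ! j)) *s wedge_list (drop_nth j vs))"
proof (induction vs)
  case Nil
  then show ?case by (simp add: wedge_list_Nil contract_one)
next
  case (Cons v vs)
  then show ?case
    by (simp add: wedge_list_Cons contract_wedge sum.lessThan_Suc_shift wedge_sum_right
          wedge_scale_right sum_negf[symmetric] del: sum.lessThan_Suc)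
qed

lemma herm_add_right: "herm A (B + C) = herm A B + herm A C"
  by (simp add: herm_def algebra_simps sum.distrib)

lemma herm_scale_right: "herm A (c *s B) = c * herm A B"
  by (simp add: herm_def algebra_simps sum_distrib_left)

lemma herm_commute: "herm B A = conjugate (herm A B)"
  by (simp add: herm_def sum_conjugate conjugate_dist_mul mult_ac)

lemma herm_sum_right: "herm A (\<Sum>j\<in>S. f j) = (\<Sum>j\<in>S. herm A (f j))"
  by (induction S rule: infinite_finite_induct) (simp_all add: herm_add_right, simp_all add: herm_def)

lemma gram_det_Cons:
  assumes "length vs = Suc (length us)"
  shows "gram_det (u # us) vs =
    (\<Sum>j<length vs. ((- 1) ^ j * herm u (vs ! j)) * gram_det us (drop_nth j vs))"
proof -
  let ?M = "Matrix.mat (length (u # us)) (length vs) (\<lambda>(i, j). herm ((u # us) ! i) (vs ! j))"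
  have "gram_det (u # us) vs = (\<Sum>j<length vs. ?M $$ (0, j) * cofactor ?M 0 j)"
    unfolding gram_det_def
    by (rule laplace_expansion_row) (use assms in auto)
  also have "\<dots> = (\<Sum>j<length vs. ((- 1) ^ j * herm u (vs ! j)) * gram_det us (drop_nth j vs))"
  proof (rule sum.cong[OF refl])
    fix j assume j: "j \<in> {..<length vs}"
    have "mat_delete ?M 0 j =
      Matrix.mat (length us) (length (drop_nth j vs)) (\<lambda>(i, k). herm (us ! i) (drop_nth j vs ! k))"
      using j assms by (intro eq_matI) (auto simp: mat_delete_def nth_append)
    then have "cofactor ?M 0 j = (- 1) ^ j * gram_det us (drop_nth j vs)"
      unfolding cofactor_def gram_det_def by simp
    then show "?M $$ (0, j) * cofactor ?M 0 j =
        ((- 1) ^ j * herm u (vs ! j)) * gram_det us (drop_nth j vs)"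
      using j by simp
  qed
  finally show ?thesis .
qed

lemma herm_wedge_list:
  "herm (wedge_list us) (wedge_list vs) = (if length us = length vs then gram_det us vs else 0)"
proof (induction us arbitrary: vs)
  case Nil
  show ?case
  proof (cases vs)
    case Nil
    then show ?thesis
      by (simp add: wedge_list_Nil herm_def mv_one_def axis_def gram_det_def
            if_distrib[of conjugate] if_distrib[of "\<lambda>a. _ * a"] cong: if_cong)
  next
    case (Cons v vs')
    have "wedge_list vs $ {} = 0" by (simp add: Cons wedge_list_Cons wedge_vector_nth)
    then show ?thesis using Cons
      by (auto simp: wedge_list_Nil herm_def mv_one_def axis_def intro!: sum.neutral)
  qed
next
  case (Cons u us)
  have "herm (wedge_list (u # us)) (wedge_list vs) =
    (\<Sum>j<length vs. ((- 1) ^ j * herm u (vs ! j)) * herm (wedge_list us) (wedge_list (drop_nth j vs)))"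
    by (simp add: wedge_list_Cons herm_wedge_left contract_wedge_list herm_sum_right herm_scale_right)
  also have "\<dots> = (\<Sum>j<length vs. ((- 1) ^ j * herm u (vs ! j)) *
      (if Suc (length us) = length vs then gram_det us (drop_nth j vs) else 0))"
    by (rule sum.cong) (auto simp: Cons.IH)
  also have "\<dots> = (if length (u # us) = length vs then gram_det (u # us) vs else 0)"
    by (auto simp: gram_det_Cons)
  finally show ?case .
qed

lemma is_grassmann_inner_herm: "is_grassmann_inner herm"
  unfolding is_grassmann_inner_def
  by (intro conjI allI impI herm_commute) (simp_all add: herm_add_right herm_scale_right herm_wedge_list)

lemma is_grassmann_inner_expand:
  assumes "is_grassmann_inner ip"
  shows "ip A B = (\<Sum>K\<in>UNIV. B $ K * ip A (axis K 1))"
proof -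
  have add: "ip A (B + C) = ip A B + ip A C" and sc: "ip A (c *s B) = c * ip A B" for B C c
    using assms unfolding is_grassmann_inner_def by blast+
  have z: "ip A 0 = 0" using sc[of 0 0] by simp
  have "ip A (\<Sum>K\<in>S. B $ K *s axis K 1) = (\<Sum>K\<in>S. B $ K * ip A (axis K 1))" for S
    by (induction S rule: infinite_finite_induct) (simp_all add: z add sc)
  from this[of UNIV] show ?thesis by (simp add: basis_expansion)
qed

lemma is_grassmann_inner_unique:
  assumes ip: "is_grassmann_inner ip" and iq: "is_grassmann_inner iq"
  shows "ip = iq"
proof (intro ext)
  fix A B
  have ax: "ip (axis K 1) (axis L 1) = iq (axis K 1) (axis L 1)" for K L
  proof -
    obtain us vs where "wedge_list us = (axis K 1 :: 'a ^ ('b set))" "wedge_list vs = (axis L 1 :: 'a ^ ('b set))"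
      using ex_wedge_list_axis by metis
    then show ?thesis using ip iq unfolding is_grassmann_inner_def by metis
  qed
  have ax': "ip (axis K 1) C = iq (axis K 1) C" for K C
    by (simp add: is_grassmann_inner_expand[OF ip, of _ C] is_grassmann_inner_expand[OF iq, of _ C] ax)
  have "ip C (axis K 1) = iq C (axis K 1)" for K C
    using ip iq ax'[of K C] unfolding is_grassmann_inner_def by metis
  then show "ip A B = iq A B"
    by (simp add: is_grassmann_inner_expand[OF ip, of _ B] is_grassmann_inner_expand[OF iq, of _ B])
qed

theorem ex1_grassmann_inner: "\<exists>!ip. is_grassmann_inner ip"
  using is_grassmann_inner_herm is_grassmann_inner_unique by blast

theorem is_grassmann_inner_grassmann_inner: "is_grassmann_inner grassmann_inner"
  unfolding grassmann_inner_def by (rule theI'[OF ex1_grassmann_inner])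

lemma grassmann_inner_eq_herm: "grassmann_inner = herm"
  using is_grassmann_inner_grassmann_inner is_grassmann_inner_herm by (rule is_grassmann_inner_unique)

lemma grassmann_inner_self_real: "grassmann_inner B B = (norm B)\<^sup>2" for B :: "real ^ ('n::finite set)"
  by (simp add: grassmann_inner_eq_herm inner_eq_herm[symmetric] power2_norm_eq_inner)

lemma grassmann_inner_self_complex:
  "grassmann_inner B B = complex_of_real ((norm B)\<^sup>2)" for B :: "complex ^ ('n::finite set)"
proof (rule complex_eqI)
  show "Re (grassmann_inner B B) = Re (complex_of_real ((norm B)\<^sup>2))"
    by (simp add: grassmann_inner_eq_herm inner_eq_Re_herm[symmetric] power2_norm_eq_inner)
  show "Im (grassmann_inner B B) = Im (complex_of_real ((norm B)\<^sup>2))"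
    by (simp add: grassmann_inner_eq_herm herm_def mult.commute)
qed

end

theory Submission
  imports Defs
begin

text \<open>
  Both volumes and both norms are computed by appending one vector \<open>v\<close> at a time. Write
  \<open>v = u + w\<close> with \<open>w\<close> in the span of the earlier vectors and \<open>u\<close> orthogonal to them. In the
  Grassmann algebra \<open>w\<close> disappears, because a vector of the span annihilates the wedge product of
  the earlier vectors; and wedging with the orthogonal vector \<open>u\<close> multiplies the norm by
  \<open>\<parallel>u\<parallel>\<close>, because contraction by \<open>u\<close> is adjoint to wedging with \<open>u\<close>, is an antiderivation, and
  kills the earlier vectors (\<open>herm_wedge_list_snoc\<close>). Over \<open>\<real>\<close> this is exactly
  the recursion that defines the volume.

  Over \<open>\<complex>\<close> the real list \<open>v1, \<i>v1, ..., vp, \<i>vp\<close> has a span that is stable under \<open>\<i>\<close>, so being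
  orthogonal to it in the Euclidean sense is the same as being Hermitian-orthogonal to
  \<open>v1, ..., vp\<close>. Appending \<open>v\<close> and then \<open>\<i>v\<close> therefore first contributes \<open>\<parallel>u\<parallel>\<close>, with the
  same \<open>u\<close> as in the Grassmann norm; and the component of \<open>\<i>v\<close> orthogonal to the
  longer list is \<open>\<i>u\<close>, since \<open>u\<close> and \<open>\<i>u\<close> are perpendicular for the real part of a Hermitian
  product. So the volume is multiplied by \<open>\<parallel>u\<parallel>\<^sup>2\<close> where the norm is multiplied by \<open>\<parallel>u\<parallel>\<close>.
\<close>

section \<open>Orthogonal components\<close>

lemma span_perp_part:
  fixes v :: "'a::euclidean_space"
  shows "v - perp_part vs v \<in> span (set vs)"
    and "x \<in> set vs \<Longrightarrow> x \<bullet> perp_part vs v = 0"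
proof -
  obtain c where
    c: "perp_part vs v = v - (\<Sum>j<length vs. c j *\<^sub>R vs ! j)"
       "\<forall>j<length vs. vs ! j \<bullet> perp_part vs v = 0"
    using theI'[OF ex1_perp_part[of v vs]] unfolding perp_part_def by blast
  have "(\<Sum>j<length vs. c j *\<^sub>R vs ! j) \<in> span (set vs)"
    by (intro span_sum span_scale span_base) auto
  then show "v - perp_part vs v \<in> span (set vs)"
    using c(1) by simp
  show "x \<in> set vs \<Longrightarrow> x \<bullet> perp_part vs v = 0"
    using c(2) by (metis in_set_conv_nth)
qed

lemma orthogonal_span:
  fixes u :: "'a::real_inner"
  assumes "w \<in> span S" and "\<And>x. x \<in> S \<Longrightarrow> x \<bullet> u = 0"
  shows "w \<bullet> u = 0"
proof -
  have "subspace {x. x \<bullet> u = 0}"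
    by (auto simp: subspace_def inner_add_left)
  then show ?thesis
    using span_minimal[of S "{x. x \<bullet> u = 0}"] assms by blast
qed

text \<open>Two candidates for the orthogonal component differ by a vector that lies in the span and is
  orthogonal to it. This identifies the component without exhibiting coefficients.\<close>

lemma perp_part_eqI:
  fixes v :: "'a::euclidean_space"
  assumes "v - u \<in> span (set vs)" and "\<And>x. x \<in> set vs \<Longrightarrow> x \<bullet> u = 0"
  shows "perp_part vs v = u"
proof -
  let ?d = "u - perp_part vs v"
  have "?d = (v - perp_part vs v) - (v - u)" by simp
  then have "?d \<in> span (set vs)"
    using span_diff[OF span_perp_part(1)[of v vs] assms(1)] by simp
  then have "?d \<bullet> ?d = 0"
    by (rule orthogonal_span) (simp add: inner_diff_right assms(2) span_perp_part(2))
  then show ?thesis by simp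
qed

lemma parallelotope_vol_snoc:
  fixes v :: "'a::euclidean_space"
  shows "parallelotope_vol (vs @ [v]) = parallelotope_vol vs * norm (perp_part vs v)"
proof (cases vs)
  case Nil
  have "perp_part [] v = v" by (rule perp_part_eqI) simp_all
  then show ?thesis using Nil by simp
next
  case (Cons w ws)
  then show ?thesis by (cases ws) (simp_all add: butlast_append)
qed

section \<open>Appending a vector to a wedge product\<close>

lemma mv_vector_add: "mv_vector (u + v) = mv_vector u + mv_vector v"
  by (simp add: mv_vector_nth Finite_Cartesian_Product.vec_eq_iff flip: sum.distrib)
     (auto intro!: sum.cong)

lemma mv_vector_scale: "mv_vector (c *s u) = c *s mv_vector u"
  by (simp add: mv_vector_nth Finite_Cartesian_Product.vec_eq_iff sum_distrib_left)
     (auto intro!: sum.cong)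

text \<open>Polarization of \<open>wedge_vector_self\<close>.\<close>

lemma wedge_vector_anticommute: "mv_vector u \<and>\<^sub>G mv_vector v = - (mv_vector v \<and>\<^sub>G mv_vector u)"
proof -
  have "mv_vector (u + v) \<and>\<^sub>G mv_vector (u + v) = 0" by (rule wedge_vector_self)
  then have "mv_vector u \<and>\<^sub>G mv_vector v + mv_vector v \<and>\<^sub>G mv_vector u = 0"
    by (simp add: mv_vector_add wedge_add_left wedge_add_right wedge_vector_self add.commute)
  then show ?thesis by (rule eq_neg_iff_add_eq_0[THEN iffD2])
qed

lemma wedge_minus_left: "(- A) \<and>\<^sub>G B = - (A \<and>\<^sub>G B)"
  by (simp add: wedge_def Finite_Cartesian_Product.vec_eq_iff sum_negf)

lemma wedge_vector_left_commute:
  "mv_vector u \<and>\<^sub>G (mv_vector v \<and>\<^sub>G A) = - (mv_vector v \<and>\<^sub>G (mv_vector u \<and>\<^sub>G A))"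
  by (metis wedge_assoc wedge_vector_anticommute wedge_minus_left)

lemma wedge_list_snoc: "wedge_list (us @ [v]) = (- 1) ^ length us *s (mv_vector v \<and>\<^sub>G wedge_list us)"
proof (induction us)
  case Nil
  then show ?case by (simp add: wedge_list_Cons)
next
  case (Cons u us)
  then show ?case
    by (simp add: wedge_list_Cons wedge_scale_right wedge_vector_left_commute[of u])
qed

lemma wedge_list_member: "x \<in> set us \<Longrightarrow> mv_vector x \<and>\<^sub>G wedge_list us = 0"
proof (induction us)
  case (Cons u us)
  show ?case
  proof (cases "x = u")
    case True
    then show ?thesis
      by (simp add: wedge_list_Cons wedge_vector_self flip: wedge_assoc)
         (simp add: wedge_def Finite_Cartesian_Product.vec_eq_iff)
  next
    case False
    then have "mv_vector x \<and>\<^sub>G wedge_list us = 0" using Cons by simp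
    then show ?thesis
      by (simp add: wedge_list_Cons wedge_vector_left_commute[of x])
         (simp add: wedge_def Finite_Cartesian_Product.vec_eq_iff)
  qed
qed simp

text \<open>Real subspaces suffice over both fields: the volumes are built from real spans.\<close>

lemma subspace_annihilator:
  fixes A :: "'f::{field, real_normed_field} ^ ('n::finite set)"
  shows "subspace {w. mv_vector w \<and>\<^sub>G A = 0}"
proof -
  have "c *\<^sub>R w = of_real c *s w" for c and w :: "'f ^ 'n"
    unfolding Finite_Cartesian_Product.vec_eq_iff by simp (simp add: scaleR_conv_of_real)
  moreover have "mv_vector 0 \<and>\<^sub>G A = 0"
    using mv_vector_scale[of 0 "0 :: 'f ^ 'n"] wedge_scale_left[of 0 "mv_vector 0" A] by simp
  ultimately show ?thesis
    by (auto simp: subspace_def mv_vector_add mv_vector_scale wedge_add_left wedge_scale_left)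
qed

text \<open>The adjoint of wedging with \<open>u\<close> is contraction by \<open>u\<close>, and contracting \<open>u \<and> A\<close> leaves only
  \<open>herm u u *s A\<close> when \<open>u\<close> is orthogonal to the factors of \<open>A\<close>.\<close>

lemma herm_wedge_orthogonal:
  assumes "\<And>x. x \<in> set us \<Longrightarrow> herm u x = 0"
  shows "herm (mv_vector u \<and>\<^sub>G wedge_list us) (mv_vector u \<and>\<^sub>G wedge_list us)
       = herm u u * herm (wedge_list us) (wedge_list us)"
proof -
  have "contract u (wedge_list us) = 0"
    unfolding contract_wedge_list by (rule sum.neutral) (simp add: assms)
  moreover have "mv_vector u \<and>\<^sub>G 0 = 0"
    by (simp add: wedge_def Finite_Cartesian_Product.vec_eq_iff)
  ultimately show ?thesis
    by (simp add: herm_wedge_left contract_wedge herm_scale_right)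
qed

text \<open>The Grassmann counterpart of the volume recursion. The first hypothesis is how the span
  condition on \<open>v - u\<close> enters: in this form it covers a real span over either field.\<close>

lemma herm_wedge_list_snoc:
  assumes "mv_vector (v - u) \<and>\<^sub>G wedge_list us = 0" and "\<And>x. x \<in> set us \<Longrightarrow> herm x u = 0"
  shows "herm (wedge_list (us @ [v])) (wedge_list (us @ [v]))
       = herm u u * herm (wedge_list us) (wedge_list us)"
proof -
  have "herm u x = 0" if "x \<in> set us" for x
    using assms(2)[OF that] by (simp add: herm_commute[of x u])
  note orth = herm_wedge_orthogonal[of us u, OF this]
  have "mv_vector v \<and>\<^sub>G wedge_list us = mv_vector u \<and>\<^sub>G wedge_list us"
    using assms(1) mv_vector_add[of "v - u" u] by (simp add: wedge_add_left)
  then have snoc: "wedge_list (us @ [v]) = (- 1) ^ length us *s (mv_vector u \<and>\<^sub>G wedge_list us)"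
    by (simp add: wedge_list_snoc)
  \<comment> \<open>Reordering costs only a sign, which is invisible in the Hermitian square.\<close>
  have "herm (- A) (- A) = herm A A" for A :: "'a ^ 'b set"
    by (simp add: herm_def conjugate_neg)
  then show ?thesis
    unfolding snoc using orth by (cases "even (length us)") simp_all
qed

section \<open>Real scalars\<close>

lemma norm_wedge_list_real: "norm (wedge_list us) = parallelotope_vol us"
  for us :: "(real ^ 'n::finite) list"
proof (induction us rule: rev_induct)
  case Nil
  have "(norm (wedge_list [] :: real ^ 'n set))\<^sup>2 = 1"
    by (simp add: power2_norm_eq_inner inner_eq_herm herm_wedge_list gram_det_def)
  then show ?case by (simp add: power2_eq_1_iff) (smt (verit) norm_ge_zero)
next
  case (snoc v us)
  let ?u = "perp_part us v"
  have "span (set us) \<subseteq> {w. mv_vector w \<and>\<^sub>G wedge_list us = 0}"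
    by (rule span_minimal) (auto simp: wedge_list_member subspace_annihilator)
  then have "mv_vector (v - ?u) \<and>\<^sub>G wedge_list us = 0"
    using span_perp_part(1) by blast
  moreover have "herm x ?u = 0" if "x \<in> set us" for x
    using span_perp_part(2)[OF that] by (simp add: inner_eq_herm)
  ultimately have "herm (wedge_list (us @ [v])) (wedge_list (us @ [v]))
      = herm ?u ?u * herm (wedge_list us) (wedge_list us)"
    by (rule herm_wedge_list_snoc)
  then have "(norm (wedge_list (us @ [v])))\<^sup>2 = (norm (wedge_list us) * norm ?u)\<^sup>2"
    by (simp add: power2_norm_eq_inner inner_eq_herm power_mult_distrib)
  then have "norm (wedge_list (us @ [v])) = norm (wedge_list us) * norm ?u"
    by (rule power2_eq_imp_eq) simp_all
  then show ?case by (simp add: snoc.IH parallelotope_vol_snoc)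
qed

section \<open>Complex scalars\<close>

definition realify :: "(complex ^ 'n::finite) list \<Rightarrow> (complex ^ 'n) list" where
  "realify vs = concat (map (\<lambda>v. [v, \<i> *s v]) vs)"

lemma set_realify: "set (realify vs) = set vs \<union> (\<lambda>v. \<i> *s v) ` set vs"
  by (auto simp: realify_def)

lemma inner_i_left: "(\<i> *s x) \<bullet> u = Im (herm x u)" for x u :: "complex ^ 'n::finite"
  by (simp add: inner_eq_Re_herm herm_def)

lemma inner_i_right: "x \<bullet> (\<i> *s u) = - Im (herm x u)" for x u :: "complex ^ 'n::finite"
  by (simp add: inner_eq_Re_herm herm_scale_right)

lemma norm_i_scale: "norm (\<i> *s u) = norm u" for u :: "complex ^ 'n::finite"
  by (simp add: norm_eq_sqrt_inner inner_i_left herm_scale_right inner_eq_Re_herm[of u])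

lemma herm_self_complex: "herm B B = complex_of_real ((norm B)\<^sup>2)" for B :: "complex ^ 'n::finite"
  by (rule complex_eqI)
     (simp_all add: power2_norm_eq_inner inner_eq_Re_herm, simp add: herm_def mult.commute)

lemma subspace_i_preimage:
  fixes S :: "(complex ^ 'n::finite) set"
  assumes "subspace S"
  shows "subspace {x. \<i> *s x \<in> S}"
proof -
  have "\<i> *s (x + y) = \<i> *s x + \<i> *s y" "\<i> *s (c *\<^sub>R x) = c *\<^sub>R (\<i> *s x)" "\<i> *s (0 :: complex ^ 'n) = 0"
    for c and x y :: "complex ^ 'n"
    by (simp_all add: Finite_Cartesian_Product.vec_eq_iff algebra_simps)
  then show ?thesis
    using assms by (simp add: subspace_def)
qed

lemma span_realify_i_closed:
  assumes "w \<in> span (set (realify vs))"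
  shows "\<i> *s w \<in> span (set (realify vs))"
proof -
  let ?S = "span (set (realify vs))"
  have "\<i> *s x \<in> ?S" if "x \<in> set (realify vs)" for x
    using that unfolding set_realify
  proof
    assume "x \<in> set vs"
    then show "\<i> *s x \<in> span (set vs \<union> (\<lambda>v. \<i> *s v) ` set vs)" by (auto intro: span_base)
  next
    assume "x \<in> (\<lambda>v. \<i> *s v) ` set vs"
    then obtain v where v: "v \<in> set vs" "x = \<i> *s v" by blast
    have "\<i> *s x = - v" by (simp add: v Finite_Cartesian_Product.vec_eq_iff flip: mult.assoc)
    then show "\<i> *s x \<in> span (set vs \<union> (\<lambda>v. \<i> *s v) ` set vs)"
      using v(1) by (simp add: span_base span_neg)
  qed
  then have "?S \<subseteq> {x. \<i> *s x \<in> ?S}"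
    by (intro span_minimal subspace_i_preimage) auto
  then show ?thesis using assms by blast
qed

text \<open>Orthogonality to \<open>x\<close> and to \<open>\<i>x\<close> makes the real and the imaginary part of \<open>herm x u\<close>
  vanish.\<close>

lemma herm_perp_part_realify:
  assumes "x \<in> set vs"
  shows "herm x (perp_part (realify vs) v) = 0"
proof (rule complex_eqI)
  have "x \<in> set (realify vs)" "\<i> *s x \<in> set (realify vs)"
    using assms by (auto simp: set_realify)
  from this[THEN span_perp_part(2)]
  show "Re (herm x (perp_part (realify vs) v)) = Re 0" "Im (herm x (perp_part (realify vs) v)) = Im 0"
    by (simp_all add: inner_eq_Re_herm[symmetric] inner_i_left)
qed

text \<open>Multiplication by \<open>\<i>\<close> maps the real span of the list to itself, hence its
  orthogonal complement as well, and turns \<open>u\<close> into a vector perpendicular to \<open>u\<close>.\<close>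

lemma perp_part_realify_i:
  "perp_part (realify vs @ [v]) (\<i> *s v) = \<i> *s perp_part (realify vs) v"
proof (rule perp_part_eqI)
  let ?u = "perp_part (realify vs) v"
  have "\<i> *s v - \<i> *s ?u = \<i> *s (v - ?u)"
    by (simp add: Finite_Cartesian_Product.vec_eq_iff algebra_simps)
  also have "\<dots> \<in> span (set (realify vs))"
    by (intro span_realify_i_closed span_perp_part(1))
  also have "\<dots> \<subseteq> span (set (realify vs @ [v]))"
    by (rule span_mono) auto
  finally show "\<i> *s v - \<i> *s ?u \<in> span (set (realify vs @ [v]))" .
  have perp: "x \<bullet> (\<i> *s ?u) = 0" if "x \<in> set (realify vs)" for x
  proof -
    have "\<i> *s x \<in> span (set (realify vs))"
      using that by (intro span_realify_i_closed span_base)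
    then have "(\<i> *s x) \<bullet> ?u = 0"
      by (rule orthogonal_span) (rule span_perp_part(2))
    then show ?thesis by (simp add: inner_i_left inner_i_right)
  qed
  have "(v - ?u) \<bullet> (\<i> *s ?u) = 0"
    using span_perp_part(1) perp by (rule orthogonal_span)
  moreover have "?u \<bullet> (\<i> *s ?u) = 0"
    by (simp add: inner_i_right herm_self_complex)
  ultimately have "v \<bullet> (\<i> *s ?u) = 0" by (simp add: inner_diff_left)
  then show "x \<bullet> (\<i> *s ?u) = 0" if "x \<in> set (realify vs @ [v])" for x
    using that perp by auto
qed

text \<open>Squared, so that each appended vector multiplies both sides by \<open>(norm u)\<^sup>2\<close>: on the right,
  one factor \<open>norm u\<close> comes from \<open>v\<close> and one from \<open>\<i> *s v\<close>.\<close>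

lemma norm_wedge_list_complex: "(norm (wedge_list vs))\<^sup>2 = parallelotope_vol (realify vs)"
  for vs :: "(complex ^ 'n::finite) list"
proof (induction vs rule: rev_induct)
  case Nil
  show ?case
    by (simp add: power2_norm_eq_inner inner_eq_Re_herm herm_wedge_list gram_det_def realify_def)
next
  case (snoc v vs)
  let ?u = "perp_part (realify vs) v"
  have "mv_vector (\<i> *s x) \<and>\<^sub>G wedge_list vs = 0" if "x \<in> set vs" for x
    using wedge_list_member[OF that] by (simp add: mv_vector_scale wedge_scale_left)
  then have "span (set (realify vs)) \<subseteq> {w. mv_vector w \<and>\<^sub>G wedge_list vs = 0}"
    by (intro span_minimal subspace_annihilator) (auto simp: set_realify wedge_list_member)
  then have "mv_vector (v - ?u) \<and>\<^sub>G wedge_list vs = 0"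
    using span_perp_part(1) by blast
  then have "herm (wedge_list (vs @ [v])) (wedge_list (vs @ [v]))
      = herm ?u ?u * herm (wedge_list vs) (wedge_list vs)"
    by (rule herm_wedge_list_snoc) (rule herm_perp_part_realify)
  then have "(norm (wedge_list (vs @ [v])))\<^sup>2 = (norm ?u)\<^sup>2 * (norm (wedge_list vs))\<^sup>2"
    unfolding herm_self_complex of_real_mult[symmetric] of_real_eq_iff .
  moreover have "realify (vs @ [v]) = (realify vs @ [v]) @ [\<i> *s v]"
    by (simp add: realify_def)
  ultimately show ?case
    by (simp only: parallelotope_vol_snoc perp_part_realify_i norm_i_scale snoc.IH)
       (simp add: power2_eq_square mult_ac)
qed

section \<open>Norms of blades are volumes\<close>

theorem theorem4p1:
  fixes us :: "(real ^ 'n::finite) list" and vs :: "(complex ^ 'm::finite) list"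
  shows "mv_norm_real (wedge_list us) = parallelotope_vol us \<and>
         mv_norm_complex (wedge_list vs) =
           sqrt (parallelotope_vol (concat (map (\<lambda>v. [v, \<i> *s v]) vs)))"
  by (simp add: mv_norm_real_def mv_norm_complex_def grassmann_inner_self_real
        grassmann_inner_self_complex flip: norm_wedge_list_real norm_wedge_list_complex realify_def)

end
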